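(* Let $A\in\mathbb{R}^{n\times n}$ and $C\in\mathbb{R}^{n_y\times n}$ with $(A,C)$ observable, and consider the system $\dot x(t)=Ax(t)$, $y(t)=Cx(t)$. Let $G\in\mathbb{R}^{n\times n}$, $L,E,N_c\in\mathbb{R}^{n\times n_y}$ and $\theta\in\mathbb{R}^{n_y\times n_y}$ with $\theta=\theta^T\ge 0$, and consider the cubic observer $$\dot w_c(t)=Gw_c(t)+Ly(t)-\big(e_c^T(t)C^T\theta Ce_c(t)\big)N_cCe_c(t),\qquad \hat x_c(t)=w_c(t)+Ey(t),$$ where $e_c(t)=x(t)-\hat x_c(t)$. Suppose that (i) $(I-EC)A-G(I-EC)-LC=0$; (ii) there is no vector $v\in\mathbb{R}^n$, $v\neq 0$, with $Gv+(v^TC^T\theta Cv)N_cCv=0$; (iii) there exists $P=P^T>0$ in $\mathbb{R}^{n\times n}$ such that $G^TP+PG<0$ and $PN_cC+C^TN_c^TP<0$. Then the estimation error dynamics (the dynamics of $e_c$) is globally stable.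
   Context: Matrix inequalities such as $M>0$, $M\ge 0$, $M<0$ are in the sense of (semi)definiteness of symmetric matrices. The term "globally stable" is used without a further definition; the result is presented as a convergence criterion for the observer, whose state estimate $\hat x_c$ is aimed to converge to $x$. *)

theory Defs
  imports "HOL-Analysis.Analysis"
begin

definition pos_semidef :: "real ^ 'n ^ 'n \<Rightarrow> bool" where
  "pos_semidef M \<longleftrightarrow> transpose M = M \<and> (\<forall>v. v \<bullet> (M *v v) \<ge> 0)"

definition pos_def :: "real ^ 'n ^ 'n \<Rightarrow> bool" where
  "pos_def M \<longleftrightarrow> transpose M = M \<and> (\<forall>v. v \<noteq> 0 \<longrightarrow> v \<bullet> (M *v v) > 0)"

definition neg_def :: "real ^ 'n ^ 'n \<Rightarrow> bool" where
  "neg_def M \<longleftrightarrow> transpose M = M \<and> (\<forall>v. v \<noteq> 0 \<longrightarrow> v \<bullet> (M *v v) < 0)"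

definition linear_trajectory :: "real ^ 'n ^ 'n \<Rightarrow> (real \<Rightarrow> real ^ 'n) \<Rightarrow> bool" where
  "linear_trajectory A x \<longleftrightarrow>
     (\<forall>t\<ge>0. (x has_vector_derivative A *v x t) (at t within {0..}))"

text \<open>Observability in its defining form: the output on the time axis \<open>[0, \<infinity>)\<close>
  determines the initial state.\<close>

definition observable :: "real ^ 'n ^ 'n \<Rightarrow> real ^ 'n ^ 'm \<Rightarrow> bool" where
  "observable A C \<longleftrightarrow>
     (\<forall>x\<^sub>1 x\<^sub>2. linear_trajectory A x\<^sub>1 \<and> linear_trajectory A x\<^sub>2 \<and>
        (\<forall>t\<ge>0. C *v x\<^sub>1 t = C *v x\<^sub>2 t) \<longrightarrow> x\<^sub>1 0 = x\<^sub>2 0)"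

definition state_estimate ::
    "real ^ 'n ^ 'm \<Rightarrow> real ^ 'm ^ 'n \<Rightarrow> (real \<Rightarrow> real ^ 'n) \<Rightarrow> (real \<Rightarrow> real ^ 'n) \<Rightarrow> real \<Rightarrow> real ^ 'n" where
  "state_estimate C E x w t = w t + E *v (C *v x t)"

definition estimation_error ::
    "real ^ 'n ^ 'm \<Rightarrow> real ^ 'm ^ 'n \<Rightarrow> (real \<Rightarrow> real ^ 'n) \<Rightarrow> (real \<Rightarrow> real ^ 'n) \<Rightarrow> real \<Rightarrow> real ^ 'n" where
  "estimation_error C E x w t = x t - state_estimate C E x w t"

text \<open>A joint trajectory on \<open>[0, \<infinity>)\<close> of the plant (state \<open>x\<close>, output \<open>C x\<close>) and of the
  cubic observer driven by it (state \<open>w\<close>).\<close>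

definition cubic_observer_trajectory ::
    "real ^ 'n ^ 'n \<Rightarrow> real ^ 'n ^ 'm \<Rightarrow> real ^ 'n ^ 'n \<Rightarrow> real ^ 'm ^ 'n \<Rightarrow> real ^ 'm ^ 'n \<Rightarrow>
     real ^ 'm ^ 'n \<Rightarrow> real ^ 'm ^ 'm \<Rightarrow> (real \<Rightarrow> real ^ 'n) \<Rightarrow> (real \<Rightarrow> real ^ 'n) \<Rightarrow> bool" where
  "cubic_observer_trajectory A C G L E Nc \<theta> x w \<longleftrightarrow>
     linear_trajectory A x \<and>
     (\<forall>t\<ge>0. let y = C *v x t; e = estimation_error C E x w t in
        (w has_vector_derivative
          G *v w t + L *v y - (e \<bullet> ((transpose C ** \<theta> ** C) *v e)) *\<^sub>R ((Nc ** C) *v e))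
        (at t within {0..}))"

text \<open>Global asymptotic stability of the zero error: from all initial states of plant and
  observer the trajectory exists for all future time; the zero error is Lyapunov stable,
  with \<open>\<delta>\<close> independent of the plant trajectory; and the error of every trajectory tends
  to zero. The right-hand side is locally Lipschitz, so a trajectory is determined by its
  initial state and restricting to trajectories on all of \<open>[0, \<infinity>)\<close> loses nothing.\<close>

definition error_dynamics_globally_stable ::
    "real ^ 'n ^ 'n \<Rightarrow> real ^ 'n ^ 'm \<Rightarrow> real ^ 'n ^ 'n \<Rightarrow> real ^ 'm ^ 'n \<Rightarrow> real ^ 'm ^ 'n \<Rightarrow>
     real ^ 'm ^ 'n \<Rightarrow> real ^ 'm ^ 'm \<Rightarrow> bool" where
  "error_dynamics_globally_stable A C G L E Nc \<theta> \<longleftrightarrow>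
     (\<forall>x\<^sub>0 w\<^sub>0. \<exists>x w. cubic_observer_trajectory A C G L E Nc \<theta> x w \<and> x 0 = x\<^sub>0 \<and> w 0 = w\<^sub>0) \<and>
     (\<forall>\<epsilon>>0. \<exists>\<delta>>0. \<forall>x w. cubic_observer_trajectory A C G L E Nc \<theta> x w \<and>
        norm (estimation_error C E x w 0) < \<delta> \<longrightarrow>
        (\<forall>t\<ge>0. norm (estimation_error C E x w t) < \<epsilon>)) \<and>
     (\<forall>x w. cubic_observer_trajectory A C G L E Nc \<theta> x w \<longrightarrow>
        (estimation_error C E x w \<longlongrightarrow> 0) at_top)"

end

theory Submission
  imports Defs
begin

text \<open>
  The Sylvester identity \<open>(I - E C) A = G (I - E C) + L C\<close> makes the error autonomous: with
  \<open>H = N\<^sub>c C\<close> and \<open>q v = v\<^sup>T C\<^sup>T \<theta> C v \<ge> 0\<close> it satisfies \<open>e' = G e + q(e) H e\<close>, whatever the plant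
  does. The matrix inequalities say that \<open>V v = v\<^sup>T P v\<close> decreases along both linear fields \<open>G\<close> and
  \<open>H\<close>, strictly along \<open>G\<close>. Hence it decreases at least as fast along \<open>G + s H\<close> for every gain \<open>s \<ge> 0\<close>, and
  the cubic term can only help: errors obey \<open>\<parallel>e t\<parallel> \<le> b exp (- a t) \<parallel>e 0\<parallel>\<close> with constants that do not
  depend on the gain (\<open>common_lyapunov_decay\<close>). This yields both Lyapunov stability and convergence.

  Existence of trajectories for all future time is the other half, since a cubic field is not globally
  Lipschitz. In \<open>cubic_system_global_solution\<close> the argument of the cubic term is projected onto
  a ball. The truncated field is globally Lipschitz, so
  \<open>global_solution_of_lipschitz_field\<close> solves it on \<open>[0, \<infinity>)\<close>. The projection only rescales its
  argument by a nonnegative factor, so the truncated equation still has the form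
  \<open>e' = G e + s H e\<close> with \<open>s \<ge> 0\<close>; the decay estimate then keeps the solution inside a large enough ball,
  where the truncation changes nothing.
\<close>

section \<open>Global solutions of Lipschitz differential equations\<close>

text \<open>Integration against the weight \<open>exp (l s)\<close> gains a factor \<open>1 / l\<close>; this gain is what makes
  Picard iteration a contraction below.\<close>

lemma norm_integral_le_exp:
  fixes f :: "real \<Rightarrow> 'a::banach"
  assumes "continuous_on {0..t} f" "0 \<le> t" "0 < l" "0 \<le> c"
    and bound: "\<And>s. s \<in> {0..t} \<Longrightarrow> norm (f s) \<le> c * exp (l * s)"
  shows "norm (integral {0..t} f) \<le> c / l * exp (l * t)"
proof -
  have "((\<lambda>s. c * exp (l * s)) has_integral (c / l * exp (l * t) - c / l * exp (l * 0))) {0..t}"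
    using assms(2,3)
    by (intro fundamental_theorem_of_calculus)
      (auto intro!: derivative_eq_intros simp flip: has_real_derivative_iff_has_vector_derivative)
  moreover have "norm (integral {0..t} f) \<le> integral {0..t} (\<lambda>s. c * exp (l * s))"
    by (intro integral_norm_bound_integral integrable_continuous_real continuous_intros assms)
  ultimately have "norm (integral {0..t} f) \<le> c / l * exp (l * t) - c / l"
    by (simp only: integral_unique) simp
  also have "\<dots> \<le> c / l * exp (l * t)"
    using assms(3,4) by simp
  finally show ?thesis .
qed

text \<open>At a point \<open>t \<ge> a\<close>, the half-line and \<open>[a, t + 1]\<close> have the same germ, which turns the fundamental
  theorem on compact intervals into one on the half-line.\<close>

lemma integral_has_vector_derivative_atLeast:
  fixes f :: "real \<Rightarrow> 'a::banach"
  assumes "continuous_on {a..} f" "a \<le> t"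
  shows "((\<lambda>u. integral {a..u} f) has_vector_derivative f t) (at t within {a..})"
proof -
  have "((\<lambda>u. integral {a..u} f) has_vector_derivative f t) (at t within {a..t + 1})"
    using assms by (intro integral_has_vector_derivative continuous_on_subset[OF assms(1)]) auto
  moreover have "at t within {a..t + 1} = at t within {a..}"
    by (rule at_within_nhd[of _ "{..<t + 1}"]) auto
  ultimately show ?thesis by simp
qed

text \<open>Picard iteration in the space of functions of growth \<open>O(exp (l t))\<close> with the weighted supremum
  norm. With \<open>x t = exp (l t) z t\<close> this space becomes that of the bounded continuous \<open>z\<close>, which is complete, and
  the iteration contracts by \<open>K / l\<close>. A weight with \<open>l \<ge> 2 K\<close> thus gives the solution on all of
  \<open>[0, \<infinity>)\<close> at once, without continuation of local solutions.\<close>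

lemma global_solution_of_lipschitz_field:
  fixes f :: "'a::banach \<Rightarrow> 'a"
  assumes lip: "K-lipschitz_on UNIV f"
  obtains x where "x 0 = x\<^sub>0"
    and "\<And>t. 0 \<le> t \<Longrightarrow> (x has_vector_derivative f (x t)) (at t within {0..})"
proof -
  have K0: "0 \<le> K" using lip by (rule lipschitz_on_nonneg)
  have fK: "norm (f u - f v) \<le> K * norm (u - v)" for u v
    using lipschitz_onD[OF lip, of u v] by (simp add: dist_norm)
  have cont_f: "continuous_on S f" for S
    by (rule continuous_on_subset[OF lipschitz_on_continuous_on[OF lip]]) simp
  define l where "l = 2 * K + 1"
  have l: "0 < l" "K / l \<le> 1 / 2" using K0 by (auto simp: l_def field_simps)
  define integrand where "integrand z s = f (exp (l * s) *\<^sub>R apply_bcontfun z s)" for z s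
  have cont_integrand: "continuous_on S (integrand z)" for S z
    unfolding integrand_def
    by (intro continuous_on_compose2[OF cont_f[of UNIV]] continuous_intros) auto
  \<comment> \<open>Bounded continuous functions live on the whole line; \<open>max 0 t\<close> extends the iterate to negative times
    by its value at 0.\<close>
  define step where "step z t = exp (- (l * max 0 t)) *\<^sub>R (x\<^sub>0 + integral {0..max 0 t} (integrand z))"
    for z t
  have cont_int: "continuous_on UNIV (\<lambda>t. integral {0..max 0 t} (integrand z))" for z
  proof -
    have "continuous_on {0..} (\<lambda>t. integral {0..t} (integrand z))"
      unfolding continuous_on_eq_continuous_within
      by (auto intro!: has_vector_derivative_continuous[OF integral_has_vector_derivative_atLeast]
          cont_integrand)
    then show ?thesis
      by (rule continuous_on_compose2) (auto intro!: continuous_intros)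
  qed
  have step_bcontfun: "step z \<in> bcontfun" for z
  proof -
    have "norm (step z t) \<le> norm x\<^sub>0 + (norm (f 0) + K * norm z) / l" for t
    proof -
      define r where "r = max 0 t"
      have r: "0 \<le> r" by (simp add: r_def)
      have "norm (integrand z s) \<le> (norm (f 0) + K * norm z) * exp (l * s)" if "s \<in> {0..r}" for s
      proof -
        have "norm (integrand z s) \<le> norm (f 0) + norm (integrand z s - f 0)"
          by norm
        also have "\<dots> \<le> norm (f 0) + K * (exp (l * s) * norm z)"
          using fK[of "exp (l * s) *\<^sub>R z s" 0] K0 norm_bounded[of z s]
          by (auto simp: integrand_def intro!: mult_left_mono order_trans[OF fK])
        also have "\<dots> \<le> norm (f 0) * exp (l * s) + K * (exp (l * s) * norm z)"
          using that l(1) mult_left_mono[of 1 "exp (l * s)" "norm (f 0)"] by simp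
        finally show ?thesis by (simp add: algebra_simps)
      qed
      then have "norm (integral {0..r} (integrand z)) \<le> (norm (f 0) + K * norm z) / l * exp (l * r)"
        using r l K0 by (intro norm_integral_le_exp cont_integrand) auto
      then have "norm (x\<^sub>0 + integral {0..r} (integrand z))
          \<le> norm x\<^sub>0 + (norm (f 0) + K * norm z) / l * exp (l * r)"
        by (intro norm_triangle_le add_mono order_refl)
      also have "\<dots> \<le> norm x\<^sub>0 * exp (l * r) + (norm (f 0) + K * norm z) / l * exp (l * r)"
        using r l by (simp add: mult_le_cancel_left1)
      also have "\<dots> = (norm x\<^sub>0 + (norm (f 0) + K * norm z) / l) * exp (l * r)"
        by (simp add: distrib_right)
      finally have "norm (x\<^sub>0 + integral {0..r} (integrand z)) / exp (l * r)
          \<le> norm x\<^sub>0 + (norm (f 0) + K * norm z) / l"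
        by (simp only: pos_divide_le_eq exp_gt_zero)
      moreover have "norm (step z t) = norm (x\<^sub>0 + integral {0..r} (integrand z)) / exp (l * r)"
        unfolding step_def r_def[symmetric] norm_scaleR by (simp add: exp_minus divide_inverse_commute)
      ultimately show ?thesis by simp
    qed
    moreover have "continuous_on UNIV (step z)"
      unfolding step_def by (intro continuous_intros cont_int)
    ultimately show ?thesis by (auto simp: bcontfun_def bounded_iff)
  qed
  define Step where "Step z = Bcontfun (step z)" for z
  have Step_apply: "apply_bcontfun (Step z) = step z" for z
    by (simp add: Step_def Bcontfun_inverse step_bcontfun)
  have "dist (Step z) (Step z') \<le> 1 / 2 * dist z z'" for z z'
  proof (rule dist_bound)
    fix t :: real
    define r where "r = max 0 t"
    have r: "0 \<le> r" by (simp add: r_def)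
    have "norm (integrand z s - integrand z' s) \<le> (K * dist z z') * exp (l * s)" for s
    proof -
      have "norm (integrand z s - integrand z' s)
          \<le> K * norm (exp (l * s) *\<^sub>R (z s - z' s))"
        unfolding integrand_def using fK by (simp add: scaleR_diff_right)
      also have "\<dots> \<le> K * (exp (l * s) * dist z z')"
        using K0 dist_bounded[of z s z'] by (auto simp: dist_norm intro!: mult_left_mono)
      finally show ?thesis by (simp add: algebra_simps)
    qed
    then have "norm (integral {0..r} (\<lambda>s. integrand z s - integrand z' s))
        \<le> K * dist z z' / l * exp (l * r)"
      using r l K0 by (intro norm_integral_le_exp continuous_intros cont_integrand) auto
    also have "integral {0..r} (\<lambda>s. integrand z s - integrand z' s)
        = integral {0..r} (integrand z) - integral {0..r} (integrand z')"
      by (intro Henstock_Kurzweil_Integration.integral_diff integrable_continuous_real cont_integrand)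
    finally have "exp (- (l * r)) * norm (integral {0..r} (integrand z) - integral {0..r} (integrand z'))
        \<le> K / l * dist z z'"
      by (simp add: exp_minus field_simps)
    also have "\<dots> \<le> 1 / 2 * dist z z'"
      using l(2) by (intro mult_right_mono) auto
    finally show "dist (Step z t) (Step z' t) \<le> 1 / 2 * dist z z'"
      unfolding Step_apply step_def r_def[symmetric]
      by (simp add: dist_norm flip: scaleR_diff_right)
  qed
  then obtain z where z: "Step z = z"
    using banach_fix_type[of "1/2" Step] by auto
  define x where "x t = exp (l * t) *\<^sub>R z t" for t
  have x: "x t = x\<^sub>0 + integral {0..t} (\<lambda>s. f (x s))" if "0 \<le> t" for t
  proof -
    have "x t = exp (l * t) *\<^sub>R step z t"
      using z Step_apply[of z] by (simp add: x_def)
    with that show ?thesis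
      by (simp add: step_def exp_minus integrand_def[abs_def] x_def)
  qed
  show thesis
  proof
    show "x 0 = x\<^sub>0" using x[of 0] by simp
    show "(x has_vector_derivative f (x t)) (at t within {0..})" if "0 \<le> t" for t
    proof -
      have "continuous_on {0..} (\<lambda>s. f (x s))"
        using cont_integrand[of _ z] by (simp add: integrand_def[abs_def] x_def)
      then have "((\<lambda>t. x\<^sub>0 + integral {0..t} (\<lambda>s. f (x s))) has_vector_derivative 0 + f (x t))
          (at t within {0..})"
        using that by (intro has_vector_derivative_add has_vector_derivative_const
            integral_has_vector_derivative_atLeast)
      then show ?thesis
        using that x by (auto intro: has_vector_derivative_transform)
    qed
  qed
qed

section \<open>Uniform exponential decay from a common Lyapunov function\<close>

text \<open>The constant is the minimum of the form over the compact unit sphere.\<close>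

lemma quadratic_form_lower_bound:
  fixes M :: "real ^ 'n ^ 'n"
  assumes "\<And>v. v \<noteq> 0 \<Longrightarrow> 0 < v \<bullet> (M *v v)"
  obtains k where "0 < k" "\<And>v. k * (norm v)\<^sup>2 \<le> v \<bullet> (M *v v)"
proof -
  have "\<exists>u\<in>sphere 0 1. \<forall>v\<in>sphere 0 1. u \<bullet> (M *v u) \<le> v \<bullet> (M *v v)"
    by (rule continuous_attains_inf) (auto intro!: continuous_intros)
  then obtain u where u: "norm u = 1" and min: "\<And>v. norm v = 1 \<Longrightarrow> u \<bullet> (M *v u) \<le> v \<bullet> (M *v v)"
    by auto
  show thesis
  proof
    show "0 < u \<bullet> (M *v u)" using u by (intro assms) auto
    show "u \<bullet> (M *v u) * (norm v)\<^sup>2 \<le> v \<bullet> (M *v v)" for v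
    proof (cases "v = 0")
      case False
      have "v = norm v *\<^sub>R sgn v" using False by (simp add: sgn_div_norm)
      then have "v \<bullet> (M *v v) = (norm v)\<^sup>2 * (sgn v \<bullet> (M *v sgn v))"
        by (metis (no_types) inner_scaleR_left inner_scaleR_right matrix_vector_mult_scaleR
            mult.assoc power2_eq_square)
      with min[of "sgn v"] False show ?thesis
        by (simp add: norm_sgn mult.commute mult_left_mono)
    qed simp
  qed
qed

lemma quadratic_form_upper_bound:
  fixes M :: "real ^ 'n ^ 'n"
  obtains k where "0 < k" "\<And>v. v \<bullet> (M *v v) \<le> k * (norm v)\<^sup>2"
proof -
  obtain k where k: "0 < k" "\<And>v. norm (M *v v) \<le> norm v * k"
    using bounded_linear.pos_bounded[OF matrix_vector_mul_bounded_linear, of M] by auto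
  have "v \<bullet> (M *v v) \<le> k * (norm v)\<^sup>2" for v
  proof -
    have "v \<bullet> (M *v v) \<le> norm v * norm (M *v v)" by (rule norm_cauchy_schwarz)
    also have "\<dots> \<le> norm v * (norm v * k)" by (intro mult_left_mono k) auto
    finally show ?thesis by (simp add: power2_eq_square mult_ac)
  qed
  with k(1) that show thesis by blast
qed

lemma inner_transpose_matrix_vector:
  fixes M :: "real ^ 'n ^ 'm"
  shows "u \<bullet> (transpose M *v v) = (M *v u) \<bullet> v"
  by (metis dot_lmul_matrix inner_commute transpose_matrix_vector)

text \<open>The right-hand side is the derivative of \<open>v\<^sup>T P v\<close> along the linear field \<open>M v\<close>.\<close>

lemma quadratic_form_lyapunov_operator:
  fixes P M :: "real ^ 'n ^ 'n"
  shows "v \<bullet> ((P ** M + transpose M ** P) *v v) = v \<bullet> (P *v (M *v v)) + (M *v v) \<bullet> (P *v v)"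
  by (simp add: matrix_vector_mult_add_rdistrib inner_add_right matrix_vector_mul_assoc[symmetric]
      inner_transpose_matrix_vector
      del: transpose_matrix_vector)

lemma uminus_matrix_vector_mult:
  fixes M :: "'a::ring_1 ^ 'n ^ 'm"
  shows "(- M) *v v = - (M *v v)"
  by (simp add: matrix_vector_mult_def vec_eq_iff sum_negf)

text \<open>The \<open>G\<close> part alone gives \<open>V' \<le> - c V\<close> for \<open>V = e\<^sup>T P e\<close>, and a nonnegative multiple of the \<open>H\<close>
  part only lowers \<open>V'\<close>. The rate and the overshoot depend on the three matrices only, so that one
  estimate serves the cubic equation, where \<open>s t = q (e t)\<close>, as well as its truncation.\<close>

lemma common_lyapunov_decay:
  fixes G H P :: "real ^ 'n ^ 'n"
  assumes P: "pos_def P"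
    and G: "neg_def (P ** G + transpose G ** P)"
    and H: "neg_def (P ** H + transpose H ** P)"
  obtains a b where "0 < a" "0 < b"
    and "\<And>e s t. (\<And>t. 0 \<le> t \<Longrightarrow> 0 \<le> s t) \<Longrightarrow>
      (\<And>t. 0 \<le> t \<Longrightarrow> (e has_vector_derivative G *v e t + s t *\<^sub>R (H *v e t)) (at t within {0..})) \<Longrightarrow>
      0 \<le> t \<Longrightarrow> norm (e t) \<le> b * exp (- a * t) * norm (e 0)"
proof -
  obtain p where p: "0 < p" "\<And>v. p * (norm v)\<^sup>2 \<le> v \<bullet> (P *v v)"
    using quadratic_form_lower_bound[of P] P by (auto simp: pos_def_def)
  obtain p' where p': "0 < p'" "\<And>v. v \<bullet> (P *v v) \<le> p' * (norm v)\<^sup>2"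
    using quadratic_form_upper_bound[of P] by auto
  have "0 < v \<bullet> ((- (P ** G + transpose G ** P)) *v v)" if "v \<noteq> 0" for v
    using G that by (simp add: neg_def_def uminus_matrix_vector_mult del: minus_add_distrib)
  then obtain k where k: "0 < k" "\<And>v. k * (norm v)\<^sup>2 \<le> v \<bullet> ((- (P ** G + transpose G ** P)) *v v)"
    using quadratic_form_lower_bound by blast
  have decG: "v \<bullet> (P *v (G *v v)) + (G *v v) \<bullet> (P *v v) \<le> - k * (norm v)\<^sup>2" for v
    using k(2)[of v]
    by (simp add: uminus_matrix_vector_mult quadratic_form_lyapunov_operator del: minus_add_distrib)
  have decH: "v \<bullet> (P *v (H *v v)) + (H *v v) \<bullet> (P *v v) \<le> 0" for v
    using H unfolding neg_def_def quadratic_form_lyapunov_operator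
    by (cases "v = 0") (auto intro: less_imp_le)
  \<comment> \<open>From \<open>V' \<le> - k \<parallel>e\<parallel>\<^sup>2\<close> and \<open>V \<le> p' \<parallel>e\<parallel>\<^sup>2\<close>, the decay rate of \<open>V\<close>; that of \<open>\<parallel>e\<parallel>\<close> is half of it.\<close>
  define c where "c = k / p'"
  have c: "0 < c" using k p' by (simp add: c_def)
  show thesis
  proof
    show "0 < c / 2" using c by simp
    show "0 < sqrt (p' / p)" using p p' by simp
    fix e :: "real \<Rightarrow> real ^ 'n" and s :: "real \<Rightarrow> real" and t :: real
    assume s: "\<And>t. 0 \<le> t \<Longrightarrow> 0 \<le> s t"
      and e: "\<And>t. 0 \<le> t \<Longrightarrow> (e has_vector_derivative G *v e t + s t *\<^sub>R (H *v e t)) (at t within {0..})"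
      and t: "0 \<le> t"
    define V where "V r = e r \<bullet> (P *v e r)" for r
    have "exp (c * 0) * V 0 \<ge> exp (c * t) * V t"
    proof (rule DERIV_nonpos_imp_decreasing_open[OF t])
      have "continuous_on {0..} e"
        using e by (auto simp: continuous_on_eq_continuous_within
            intro: has_vector_derivative_continuous)
      then have "continuous_on {0..t} e" by (rule continuous_on_subset) auto
      then show "continuous_on {0..t} (\<lambda>r. exp (c * r) * V r)"
        unfolding V_def by (intro continuous_intros bounded_linear.continuous_on[OF matrix_vector_mul_bounded_linear])
    next
      fix r assume r: "0 < r" "r < t"
      define d where "d = G *v e r + s r *\<^sub>R (H *v e r)"
      define V' where "V' = e r \<bullet> (P *v d) + d \<bullet> (P *v e r)"
      have "at r within {0..} = at r" using r by (intro at_within_interior) auto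
      then have de: "(e has_vector_derivative d) (at r)" using e[of r] r by (simp add: d_def)
      have "((\<lambda>r. P *v e r) has_vector_derivative P *v d) (at r)"
        by (rule bounded_linear.has_vector_derivative[OF matrix_vector_mul_bounded_linear de])
      then have "(V has_vector_derivative V') (at r)"
        unfolding V_def V'_def
        by (intro bounded_bilinear.has_vector_derivative[OF bounded_bilinear_inner] de)
      then have "((\<lambda>r. exp (c * r) * V r) has_real_derivative exp (c * r) * (c * V r + V')) (at r)"
        unfolding has_real_derivative_iff_has_vector_derivative[symmetric]
        by (auto intro!: derivative_eq_intros simp: algebra_simps)
      moreover have "c * V r + V' \<le> 0"
      proof -
        have "V' = (e r \<bullet> (P *v (G *v e r)) + (G *v e r) \<bullet> (P *v e r))
            + s r * (e r \<bullet> (P *v (H *v e r)) + (H *v e r) \<bullet> (P *v e r))"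
          by (simp add: V'_def d_def matrix_vector_right_distrib matrix_vector_mult_scaleR
              inner_add_left inner_add_right algebra_simps)
        also have "\<dots> \<le> - k * (norm (e r))\<^sup>2 + s r * 0"
          using r by (intro add_mono decG mult_left_mono decH s) auto
        finally have "V' \<le> - k * (norm (e r))\<^sup>2" by simp
        moreover have "c * V r \<le> c * (p' * (norm (e r))\<^sup>2)"
          unfolding V_def using c by (intro mult_left_mono p') auto
        moreover have "c * (p' * (norm (e r))\<^sup>2) = k * (norm (e r))\<^sup>2"
          using p' by (simp add: c_def)
        ultimately show ?thesis by simp
      qed
      ultimately show "\<exists>y. ((\<lambda>r. exp (c * r) * V r) has_real_derivative y) (at r) \<and> y \<le> 0"
        by (auto simp: mult_le_0_iff)
    qed
    then have "exp (c * t) * V t \<le> V 0" by simp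
    moreover have "exp (c * t) * (p * (norm (e t))\<^sup>2) \<le> exp (c * t) * V t"
      unfolding V_def by (intro mult_left_mono p) auto
    moreover have "V 0 \<le> p' * (norm (e 0))\<^sup>2" unfolding V_def by (rule p')
    ultimately have "exp (c * t) * (p * (norm (e t))\<^sup>2) \<le> p' * (norm (e 0))\<^sup>2"
      by linarith
    then have "(norm (e t))\<^sup>2 \<le> (p' / p) * exp (- (c * t)) * (norm (e 0))\<^sup>2"
      using p by (simp add: exp_minus field_simps)
    also have "\<dots> = (sqrt (p' / p) * exp (- (c / 2) * t) * norm (e 0))\<^sup>2"
      using p p' by (simp add: power_mult_distrib flip: exp_double)
    finally show "norm (e t) \<le> sqrt (p' / p) * exp (- (c / 2) * t) * norm (e 0)"
      using p p' by (auto intro: power2_le_imp_le)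
  qed
qed

section \<open>Truncation of the cubic field\<close>

text \<open>Projecting onto a centred ball keeps the direction of a vector. A truncated linear field therefore stays
  a nonnegative multiple of that field, which is why a ball is used and not another convex body.\<close>

lemma closest_point_cball_radial:
  fixes v :: "'a::euclidean_space"
  assumes "0 < R"
  obtains c where "0 \<le> c" "closest_point (cball 0 R) v = c *\<^sub>R v"
proof (cases "norm v \<le> R")
  case True
  then show thesis using that[of 1] by (simp add: closest_point_self)
next
  case False
  \<comment> \<open>\<open>R v / \<parallel>v\<parallel>\<close> attains the lower bound \<open>\<parallel>v\<parallel> - R\<close> on the distance from \<open>v\<close> to the ball.\<close>
  have "(R / norm v) *\<^sub>R v = closest_point (cball 0 R) v"
  proof (rule closest_point_unique)
    show "\<forall>z\<in>cball 0 R. dist v ((R / norm v) *\<^sub>R v) \<le> dist v z"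
    proof
      fix z :: 'a assume "z \<in> cball 0 R"
      have "v - (R / norm v) *\<^sub>R v = ((norm v - R) / norm v) *\<^sub>R v"
        using False assms by (auto simp: diff_divide_distrib scaleR_diff_left)
      moreover have "v \<noteq> 0" using False assms by auto
      ultimately have "dist v ((R / norm v) *\<^sub>R v) = norm v - R"
        using False assms by (simp add: dist_norm)
      also have "\<dots> \<le> norm v - norm z" using \<open>z \<in> _\<close> by simp
      also have "\<dots> \<le> dist v z" by (simp add: dist_norm norm_triangle_ineq2)
      finally show "dist v ((R / norm v) *\<^sub>R v) \<le> dist v z" .
    qed
  qed (use assms in auto)
  then show thesis using that[of "R / norm v"] assms by simp
qed

text \<open>Telescoping over the three factors \<open>v\<close> of the cubic expression: each replacement of \<open>u\<close> by
  \<open>v\<close> costs at most \<open>m h R\<^sup>2 \<parallel>u - v\<parallel>\<close>.\<close>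

lemma cubic_field_lipschitz_on_cball:
  fixes M H :: "real ^ 'n ^ 'n"
  obtains K where "K-lipschitz_on (cball 0 R) (\<lambda>v. (v \<bullet> (M *v v)) *\<^sub>R (H *v v))"
proof -
  obtain m where m: "0 < m" "\<And>v. norm (M *v v) \<le> norm v * m"
    using bounded_linear.pos_bounded[OF matrix_vector_mul_bounded_linear, of M] by auto
  obtain h where h: "0 < h" "\<And>v. norm (H *v v) \<le> norm v * h"
    using bounded_linear.pos_bounded[OF matrix_vector_mul_bounded_linear, of H] by auto
  have M: "\<bar>u \<bullet> (M *v v)\<bar> \<le> norm u * (norm v * m)" for u v
    by (rule order_trans[OF Cauchy_Schwarz_ineq2]) (intro mult_left_mono m norm_ge_zero)
  have "(3 * m * h * R\<^sup>2)-lipschitz_on (cball 0 R) (\<lambda>v. (v \<bullet> (M *v v)) *\<^sub>R (H *v v))"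
  proof (rule lipschitz_onI)
    show "0 \<le> 3 * m * h * R\<^sup>2" using m h by simp
    fix u v :: "real ^ 'n"
    assume "u \<in> cball 0 R" "v \<in> cball 0 R"
    then have R: "norm u \<le> R" "norm v \<le> R" by auto
    then have R0: "0 \<le> R" using norm_ge_zero order_trans by blast
    have "(u \<bullet> (M *v u)) *\<^sub>R (H *v u) - (v \<bullet> (M *v v)) *\<^sub>R (H *v v)
        = ((u - v) \<bullet> (M *v u)) *\<^sub>R (H *v u) + (v \<bullet> (M *v (u - v))) *\<^sub>R (H *v u)
          + (v \<bullet> (M *v v)) *\<^sub>R (H *v (u - v))"
      by (simp add: matrix_vector_mult_diff_distrib inner_diff_left inner_diff_right
          scaleR_diff_left scaleR_diff_right)
    also have "norm \<dots> \<le> \<bar>(u - v) \<bullet> (M *v u)\<bar> * norm (H *v u) + \<bar>v \<bullet> (M *v (u - v))\<bar> * norm (H *v u)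
          + \<bar>v \<bullet> (M *v v)\<bar> * norm (H *v (u - v))"
      by (intro order_trans[OF norm_triangle_ineq] add_mono) auto
    also have "\<dots> \<le> (norm (u - v) * (R * m)) * (R * h) + (R * (norm (u - v) * m)) * (R * h)
          + (R * (R * m)) * (norm (u - v) * h)"
      using m(1) h(1) R R0
      by (intro add_mono mult_mono order_trans[OF M] order_trans[OF h(2)]) auto
    also have "\<dots> = 3 * m * h * R\<^sup>2 * dist u v"
      by (simp add: dist_norm power2_eq_square algebra_simps)
    finally show "dist ((u \<bullet> (M *v u)) *\<^sub>R (H *v u)) ((v \<bullet> (M *v v)) *\<^sub>R (H *v v)) \<le> 3 * m * h * R\<^sup>2 * dist u v"
      by (simp add: dist_norm)
  qed
  with that show thesis .
qed

text \<open>The truncation at radius \<open>R\<close> is harmless because the truncated system obeys the decay bound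
  \<open>\<parallel>e t\<parallel> \<le> b \<parallel>e\<^sub>0\<parallel> < R\<close>: its solution never meets the region where the field was changed.\<close>

lemma cubic_system_global_solution:
  fixes G H M P :: "real ^ 'n ^ 'n"
  assumes "pos_def P"
    and "neg_def (P ** G + transpose G ** P)"
    and "neg_def (P ** H + transpose H ** P)"
    and M: "\<And>v. 0 \<le> v \<bullet> (M *v v)"
  obtains e where "e 0 = e\<^sub>0"
    and "\<And>t. 0 \<le> t \<Longrightarrow>
      (e has_vector_derivative G *v e t + (e t \<bullet> (M *v e t)) *\<^sub>R (H *v e t)) (at t within {0..})"
proof -
  obtain a b where ab: "0 < a" "0 < b" and decay: 
    "\<And>e s t. (\<And>t. 0 \<le> t \<Longrightarrow> 0 \<le> s t) \<Longrightarrow>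
      (\<And>t. 0 \<le> t \<Longrightarrow> (e has_vector_derivative G *v e t + s t *\<^sub>R (H *v e t)) (at t within {0..})) \<Longrightarrow>
      0 \<le> t \<Longrightarrow> norm (e t) \<le> b * exp (- a * t) * norm (e 0)"
    using common_lyapunov_decay[OF assms(1-3)] by blast
  \<comment> \<open>The summand 1 keeps the radius positive when \<open>e\<^sub>0 = 0\<close>.\<close>
  define R where "R = b * norm e\<^sub>0 + 1"
  have R: "0 < R" using ab by (simp add: R_def add_nonneg_pos)
  define \<pi> :: "real ^ 'n \<Rightarrow> real ^ 'n" where "\<pi> = closest_point (cball 0 R)"
  have \<pi>_ball: "\<pi> v \<in> cball 0 R" for v
    unfolding \<pi>_def using R by (intro closest_point_in_set) auto
  have \<pi>_lip: "1-lipschitz_on UNIV \<pi>"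
    using closest_point_lipschitz[of "cball 0 R :: (real ^ 'n) set"] R
    by (intro lipschitz_onI) (auto simp: \<pi>_def)
  have "\<exists>c. 0 \<le> c \<and> \<pi> v = c *\<^sub>R v" for v
    unfolding \<pi>_def by (rule closest_point_cball_radial[OF R]) blast
  then obtain c where c: "\<And>v. 0 \<le> c v" "\<And>v. \<pi> v = c v *\<^sub>R v" by metis
  define cubic where "cubic v = (v \<bullet> (M *v v)) *\<^sub>R (H *v v)" for v
  obtain K where K: "K-lipschitz_on (cball 0 R) cubic"
    unfolding cubic_def using cubic_field_lipschitz_on_cball .
  have "(K * 1)-lipschitz_on UNIV (cubic \<circ> \<pi>)"
    by (rule lipschitz_on_compose[OF \<pi>_lip lipschitz_on_subset[OF K]]) (use \<pi>_ball in auto)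
  moreover obtain g where "g-lipschitz_on UNIV (\<lambda>v. G *v v)"
    using bounded_linear.lipschitz_boundE[OF matrix_vector_mul_bounded_linear] .
  ultimately have "(g + K * 1)-lipschitz_on UNIV (\<lambda>v. G *v v + (cubic \<circ> \<pi>) v)"
    by (intro lipschitz_on_add)
  then obtain e where e0: "e 0 = e\<^sub>0"
    and e: "\<And>t. 0 \<le> t \<Longrightarrow> (e has_vector_derivative G *v e t + (cubic \<circ> \<pi>) (e t)) (at t within {0..})"
    by (rule global_solution_of_lipschitz_field) blast
  have "norm (e t) \<le> b * exp (- a * t) * norm (e 0)" if "0 \<le> t" for t
  proof (rule decay[OF _ _ that])
    fix t :: real assume t: "0 \<le> t"
    \<comment> \<open>The truncated cubic term, read as a time-varying gain on the linear field \<open>H\<close>.\<close>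
    show "0 \<le> (\<pi> (e t) \<bullet> (M *v \<pi> (e t))) * c (e t)" by (intro mult_nonneg_nonneg M c)
    show "(e has_vector_derivative G *v e t + ((\<pi> (e t) \<bullet> (M *v \<pi> (e t))) * c (e t)) *\<^sub>R (H *v e t))
        (at t within {0..})"
      using e[OF t] by (simp add: cubic_def c(2) matrix_vector_mult_scaleR)
  qed
  moreover have "b * exp (- a * t) * norm (e 0) \<le> R" if "0 \<le> t" for t
  proof -
    have "b * exp (- a * t) * norm (e 0) \<le> b * 1 * norm (e 0)"
      using ab that by (intro mult_right_mono mult_left_mono) auto
    then show ?thesis by (simp add: R_def e0)
  qed
  ultimately have "norm (e t) \<le> R" if "0 \<le> t" for t
    using that order_trans by blast
  then have "\<pi> (e t) = e t" if "0 \<le> t" for t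
    unfolding \<pi>_def using that by (intro closest_point_self) auto
  with e have "(e has_vector_derivative G *v e t + cubic (e t)) (at t within {0..})" if "0 \<le> t" for t
    using that by fastforce
  with e0 that show thesis unfolding cubic_def by blast
qed

section \<open>Convergence of the cubic observer\<close>

lemma estimation_error_eq:
  "estimation_error C E x w t = (mat 1 - E ** C) *v x t - w t"
  by (simp add: estimation_error_def state_estimate_def matrix_vector_mult_diff_rdistrib
      matrix_vector_mul_assoc)

text \<open>The Sylvester identity cancels every occurrence of the plant state outside of the error.\<close>

lemma estimation_error_dynamics:
  assumes sylvester: "(mat 1 - E ** C) ** A - G ** (mat 1 - E ** C) - L ** C = 0"
    and traj: "cubic_observer_trajectory A C G L E Nc \<theta> x w"
    and t: "0 \<le> t"
  defines "e \<equiv> estimation_error C E x w"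
  shows "(e has_vector_derivative
    G *v e t + (e t \<bullet> ((transpose C ** \<theta> ** C) *v e t)) *\<^sub>R ((Nc ** C) *v e t)) (at t within {0..})"
proof -
  define T where "T = mat 1 - E ** C"
  define f where "f = (e t \<bullet> ((transpose C ** \<theta> ** C) *v e t)) *\<^sub>R ((Nc ** C) *v e t)"
  have TA: "T ** A = G ** T + L ** C" using sylvester by (simp add: T_def algebra_simps)
  have e_eq: "e = (\<lambda>t. T *v x t - w t)"
    unfolding e_def T_def estimation_error_eq by (rule refl)
  have dx: "(x has_vector_derivative A *v x t) (at t within {0..})"
    and dw: "(w has_vector_derivative G *v w t + L *v (C *v x t) - f) (at t within {0..})"
    using traj t unfolding cubic_observer_trajectory_def linear_trajectory_def
    by (auto simp: Let_def f_def e_def)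
  have "(e has_vector_derivative T *v (A *v x t) - (G *v w t + L *v (C *v x t) - f)) (at t within {0..})"
    unfolding e_eq
    by (intro has_vector_derivative_diff dw
        bounded_linear.has_vector_derivative[OF matrix_vector_mul_bounded_linear dx])
  moreover have "T *v (A *v x t) - (G *v w t + L *v (C *v x t) - f) = G *v e t + f"
    by (simp add: matrix_vector_mul_assoc TA e_eq matrix_vector_mult_add_rdistrib
        matrix_vector_mult_diff_distrib)
  ultimately show ?thesis by (simp only: f_def)
qed

text \<open>The converse passage: for a given plant trajectory, observer state and error determine each other, so
  existence for the coupled system reduces to existence for the plant and for the error equation
  separately.\<close>

lemma cubic_observer_trajectory_of_error:
  assumes sylvester: "(mat 1 - E ** C) ** A - G ** (mat 1 - E ** C) - L ** C = 0"
    and x: "linear_trajectory A x"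
    and e: "\<And>t. 0 \<le> t \<Longrightarrow> (e has_vector_derivative
      G *v e t + (e t \<bullet> ((transpose C ** \<theta> ** C) *v e t)) *\<^sub>R ((Nc ** C) *v e t)) (at t within {0..})"
  shows "cubic_observer_trajectory A C G L E Nc \<theta> x (\<lambda>t. (mat 1 - E ** C) *v x t - e t)"
proof -
  define T where "T = mat 1 - E ** C"
  define w where "w t = T *v x t - e t" for t
  have TA: "T ** A = G ** T + L ** C" using sylvester by (simp add: T_def algebra_simps)
  have err: "estimation_error C E x w t = e t" for t
    by (simp add: estimation_error_eq w_def T_def)
  have "(w has_vector_derivative G *v w t + L *v (C *v x t)
      - (e t \<bullet> ((transpose C ** \<theta> ** C) *v e t)) *\<^sub>R ((Nc ** C) *v e t)) (at t within {0..})"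
    if t: "0 \<le> t" for t
  proof -
    define f where "f = (e t \<bullet> ((transpose C ** \<theta> ** C) *v e t)) *\<^sub>R ((Nc ** C) *v e t)"
    have dx: "(x has_vector_derivative A *v x t) (at t within {0..})"
      using x t by (simp add: linear_trajectory_def)
    have "(w has_vector_derivative T *v (A *v x t) - (G *v e t + f)) (at t within {0..})"
      unfolding w_def f_def
      by (intro has_vector_derivative_diff e t
          bounded_linear.has_vector_derivative[OF matrix_vector_mul_bounded_linear dx])
    moreover have "T *v (A *v x t) - (G *v e t + f) = G *v w t + L *v (C *v x t) - f"
      by (simp add: matrix_vector_mul_assoc TA w_def matrix_vector_mult_add_rdistrib
          matrix_vector_mult_diff_distrib)
    ultimately show ?thesis by (simp only: f_def)
  qed
  then have "cubic_observer_trajectory A C G L E Nc \<theta> x w"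
    using x by (simp add: cubic_observer_trajectory_def Let_def err)
  then show ?thesis by (simp add: w_def[abs_def] T_def)
qed

lemma linear_trajectory_exists:
  obtains x where "linear_trajectory A x" "x 0 = x\<^sub>0"
proof -
  obtain g where "g-lipschitz_on UNIV (\<lambda>v. A *v v)"
    using bounded_linear.lipschitz_boundE[OF matrix_vector_mul_bounded_linear] .
  then obtain x where "x 0 = x\<^sub>0"
      "\<And>t. 0 \<le> t \<Longrightarrow> (x has_vector_derivative A *v x t) (at t within {0..})"
    by (rule global_solution_of_lipschitz_field) blast
  with that show thesis by (auto simp: linear_trajectory_def)
qed

lemma pos_semidef_congruence:
  assumes "pos_semidef \<theta>"
  shows "0 \<le> v \<bullet> ((transpose C ** \<theta> ** C) *v v)"
proof -
  have "v \<bullet> ((transpose C ** \<theta> ** C) *v v) = (C *v v) \<bullet> (\<theta> *v (C *v v))"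
    by (simp add: matrix_vector_mul_assoc[symmetric] inner_transpose_matrix_vector
      del: transpose_matrix_vector)
  with assms show ?thesis by (simp add: pos_semidef_def)
qed

theorem theorem1:
  fixes A G :: "real ^ 'n ^ 'n"
    and C :: "real ^ 'n ^ 'm"
    and L E Nc :: "real ^ 'm ^ 'n"
    and \<theta> :: "real ^ 'm ^ 'm"
  assumes "observable A C"
    and "pos_semidef \<theta>"
    and "(mat 1 - E ** C) ** A - G ** (mat 1 - E ** C) - L ** C = 0"
    and "\<not> (\<exists>v :: real ^ 'n. v \<noteq> 0 \<and>
          G *v v + (v \<bullet> ((transpose C ** \<theta> ** C) *v v)) *\<^sub>R ((Nc ** C) *v v) = 0)"
    and "\<exists>P :: real ^ 'n ^ 'n. pos_def P \<and>
          neg_def (transpose G ** P + P ** G) \<and>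
          neg_def (P ** Nc ** C + transpose C ** transpose Nc ** P)"
  shows "error_dynamics_globally_stable A C G L E Nc \<theta>"
proof -
  let ?err = "estimation_error C E"
  define H where "H = Nc ** C"
  obtain P where P: "pos_def P" "neg_def (P ** G + transpose G ** P)"
      "neg_def (P ** H + transpose H ** P)"
    using assms(5) by (auto simp: H_def matrix_transpose_mul matrix_mul_assoc add.commute)
  note \<theta> = pos_semidef_congruence[OF assms(2), of _ C]
  obtain a b where ab: "0 < a" "0 < b" and decay: 
    "\<And>e s t. (\<And>t. 0 \<le> t \<Longrightarrow> 0 \<le> s t) \<Longrightarrow>
      (\<And>t. 0 \<le> t \<Longrightarrow> (e has_vector_derivative G *v e t + s t *\<^sub>R (H *v e t)) (at t within {0..})) \<Longrightarrow>
      0 \<le> t \<Longrightarrow> norm (e t) \<le> b * exp (- a * t) * norm (e 0)"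
    using common_lyapunov_decay[OF P] by blast
  have bound: "norm (?err x w t) \<le> b * exp (- a * t) * norm (?err x w 0)"
    if "cubic_observer_trajectory A C G L E Nc \<theta> x w" "0 \<le> t" for x w t
    by (rule decay[OF \<theta> estimation_error_dynamics[OF assms(3) that(1), folded H_def] that(2)])
  show ?thesis
    unfolding error_dynamics_globally_stable_def
  proof (intro conjI allI impI)
    fix x\<^sub>0 w\<^sub>0 :: "real ^ 'n"
    obtain x where x: "linear_trajectory A x" "x 0 = x\<^sub>0" by (rule linear_trajectory_exists)
    obtain e where e: "e 0 = (mat 1 - E ** C) *v x\<^sub>0 - w\<^sub>0"
      and de: "\<And>t. 0 \<le> t \<Longrightarrow> (e has_vector_derivative
        G *v e t + (e t \<bullet> ((transpose C ** \<theta> ** C) *v e t)) *\<^sub>R (H *v e t)) (at t within {0..})"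
      using cubic_system_global_solution[OF P \<theta>] by blast
    show "\<exists>x w. cubic_observer_trajectory A C G L E Nc \<theta> x w \<and> x 0 = x\<^sub>0 \<and> w 0 = w\<^sub>0"
      using cubic_observer_trajectory_of_error[OF assms(3) x(1) de[unfolded H_def]] x(2) e
      by (intro exI[of _ x] exI[of _ "\<lambda>t. (mat 1 - E ** C) *v x t - e t"]) simp
  next
    fix \<epsilon> :: real assume \<epsilon>: "0 < \<epsilon>"
    have "norm (?err x w t) < \<epsilon>"
      if "cubic_observer_trajectory A C G L E Nc \<theta> x w" "norm (?err x w 0) < \<epsilon> / b" "0 \<le> t" for x w t
    proof -
      have "norm (?err x w t) \<le> b * exp (- a * t) * norm (?err x w 0)" by (rule bound[OF that(1,3)])
      also have "\<dots> \<le> b * 1 * norm (?err x w 0)"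
        using ab that by (intro mult_right_mono mult_left_mono) auto
      also have "\<dots> < \<epsilon>" using that ab by (simp add: field_simps)
      finally show ?thesis .
    qed
    with \<epsilon> ab show "\<exists>\<delta>>0. \<forall>x w. cubic_observer_trajectory A C G L E Nc \<theta> x w \<and>
        norm (?err x w 0) < \<delta> \<longrightarrow> (\<forall>t\<ge>0. norm (?err x w t) < \<epsilon>)"
      by (intro exI[of _ "\<epsilon> / b"]) auto
  next
    fix x w assume traj: "cubic_observer_trajectory A C G L E Nc \<theta> x w"
    have "((\<lambda>t. exp (- a * t)) \<longlongrightarrow> 0) at_top"
      using ab by (intro filterlim_compose[OF exp_at_bot]
          filterlim_tendsto_neg_mult_at_bot[OF tendsto_const _ filterlim_ident]) auto
    then have "((\<lambda>t. b * exp (- a * t) * norm (?err x w 0)) \<longlongrightarrow> 0) at_top"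
      by (intro tendsto_mult_left_zero tendsto_mult_right_zero)
    then show "(?err x w \<longlongrightarrow> 0) at_top"
      by (rule Lim_null_comparison[rotated])
        (use bound[OF traj] in \<open>auto intro: eventually_mono[OF eventually_ge_at_top[of 0]]\<close>)
  qed
qed

end
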